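(* Let $N\ge 2$, $N_T\ge 1$, $\Delta t>0$, $p>0$, and let $V$ be a real linear potential. Assume the nonlinear part of the potential vanishes ($f=0$). For each $n\in\{1,\dots,N_T\}$ let $\mathcal{R}_{h,n}:\mathbb{C}^{2N-2}\to\mathbb{C}^{2N-2}$ be the discrete interface operator of the classical optimized Schwarz algorithm with Robin transmission condition, as defined in the context, for given vectors $\mathbf{u}_{j,n-1}\in\mathbb{C}^{N_j}$, $j=1,\dots,N$. Then the following hold. (1) For each $n$, there exist a matrix $\mathcal{L}_{h,n}\in\mathbb{C}^{(2N-2)\times(2N-2)}$, not depending on the vectors $\mathbf{u}_{j,n-1}$, and a vector $\mathbf{d}_n\in\mathbb{C}^{2N-2}$ such that $$\mathcal{R}_{h,n}\,\mathbf{g}=\mathcal{L}_{h,n}\,\mathbf{g}+\mathbf{d}_n\qquad\text{for all }\mathbf{g}\in\mathbb{C}^{2N-2}.$$ Moreover, $\mathcal{L}_{h,n}$ has the following sparsity structure. There are complex numbers $x_n^{1,4}$, $x_n^{N,1}$ and $x_n^{j,s}$ ($2\le j\le N-1$, $s=1,2,3,4$) such that, for $\mathbf{g}=(r_1,l_2,r_2,l_3,r_3,\dots,l_{N-1},r_{N-1},l_N)^{\top}$, the vector $\mathcal{L}_{h,n}\mathbf{g}=(r_1',l_2',r_2',\dots,l_{N-1}',r_{N-1}',l_N')^{\top}$ is given by $$r_j'=x_n^{j+1,1}\,l_{j+1}+x_n^{j+1,2}\,r_{j+1}\quad(1\le j\le N-2),\qquad r_{N-1}'=x_n^{N,1}\,l_N,$$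 $$l_2'=x_n^{1,4}\,r_1,\qquad l_j'=x_n^{j-1,3}\,l_{j-1}+x_n^{j-1,4}\,r_{j-1}\quad(3\le j\le N).$$ (2) If in addition the linear potential is time-independent, $V=V(x)$, then $$\mathcal{L}_{h,1}=\mathcal{L}_{h,2}=\dots=\mathcal{L}_{h,N_T}.$$
   Context: Setting. The underlying equation is the one dimensional Schrödinger equation $i\partial_t u+\partial_{xx}u+V(t,x)u+f(t,x,u)u=0$ on $(0,T)\times(a_0,b_0)$ with homogeneous Neumann boundary conditions, where $V$ and $f$ are real-valued; here $f=0$. The time interval is divided uniformly with step $\Delta t=T/N_T$, $t_n=n\Delta t$. Write $V_n=V(t_n,\cdot)$ for $0\le n\le N_T$ (assumed regular enough that the integrals below exist) and $W_n=(V_n+V_{n-1})/2$ for $1\le n\le N_T$. After the time discretization, the unknown $v_n$ at step $n$ solves $\frac{2i}{\Delta t}v_n+\partial_{xx}v_n+W_nv_n=\frac{2i}{\Delta t}u_{n-1}$, where $u_{n-1}$ is known. Domain decomposition. $(a_0,b_0)$ is split into $N$ consecutive non-overlapping subdomains $\Omega_j=(a_j,b_j)$, $j=1,\dots,N$, with $a_1=a_0$, $b_j=a_{j+1}$ for $1\le j\le N-1$, and $b_N=b_0$. Finite elements. Each $\Omega_j$ carries a mesh $a_j=x_{j,1}<\dots<x_{j,N_j}=b_j$ with $N_j\ge2$ nodes and the associated real $\mathbb{P}_1$ (continuous piecewise linear) nodal basis $\phi_{j,1},\dots,\phi_{j,N_j}$. Define the $N_j\times N_j$ matrices - mass matrix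 $(\mathbb{M}_j)_{\alpha\beta}=\int_{a_j}^{b_j}\phi_{j,\alpha}\phi_{j,\beta}\,dx$, - stiffness matrix $(\mathbb{S}_j)_{\alpha\beta}=\int_{a_j}^{b_j}\phi_{j,\alpha}'\phi_{j,\beta}'\,dx$, - generalized mass matrix $(\mathbb{M}_{j,W_n})_{\alpha\beta}=\int_{a_j}^{b_j}W_n\phi_{j,\alpha}\phi_{j,\beta}\,dx$, - $\mathbb{A}_{j,n}=\frac{2i}{\Delta t}\mathbb{M}_j-\mathbb{S}_j+\mathbb{M}_{j,W_n}$. Let $Q_{j,l}=(1,0,\dots,0)$ and $Q_{j,r}=(0,\dots,0,1)$ be row vectors in $\mathbb{C}^{1\times N_j}$, and let $Q_j\in\mathbb{C}^{2\times N_j}$ be the matrix with rows $Q_{j,l},Q_{j,r}$. The boundary matrix is $\mathbb{M}^{\Gamma_j}=\mathrm{diag}(1,0,\dots,0,1)$ for $2\le j\le N-1$ (equal to the identity if $N_j=2$). For the two extreme subdomains, where the homogeneous Neumann condition is imposed at $a_1$ and $b_N$, only the interface node is retained: $\mathbb{M}^{\Gamma_1}=\mathrm{diag}(0,\dots,0,1)$ and $\mathbb{M}^{\Gamma_N}=\mathrm{diag}(1,0,\dots,0)$. Interface operator. Fix $n\in\{1,\dots,N_T\}$ and given vectors $\mathbf{u}_{j,n-1}\in\mathbb{C}^{N_j}$ (the known nodal values of $u_{n-1}$ on $\Omega_j$, not depending on $\mathbf{g}$). For $\mathbf{g}=(r_1,l_2,r_2,\dots,l_{N-1},r_{N-1},l_N)^{\top}\in\mathbb{C}^{2N-2}$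 (for $N=2$, $\mathbf{g}=(r_1,l_2)^\top$), set $l_1=r_N=0$ and, for $j=1,\dots,N$, let $\mathbf{v}_j\in\mathbb{C}^{N_j}$ be the unique solution of the local problem $$\big(\mathbb{A}_{j,n}+ip\,\mathbb{M}^{\Gamma_j}\big)\mathbf{v}_j=\frac{2i}{\Delta t}\mathbb{M}_j\mathbf{u}_{j,n-1}-\mathbb{M}^{\Gamma_j}Q_j^{\top}\begin{pmatrix}l_j\\ r_j\end{pmatrix}$$ (the matrix on the left is invertible since $p>0$, $\Delta t>0$ and $W_n$ is real). Then $$\mathcal{R}_{h,n}\mathbf{g}=(\hat r_1,\hat l_2,\hat r_2,\dots,\hat l_{N-1},\hat r_{N-1},\hat l_N)^{\top},$$ where $$\hat l_j=-r_{j-1}-2ip\,Q_{j-1,r}\mathbf{v}_{j-1}\quad(2\le j\le N),\qquad \hat r_j=-l_{j+1}-2ip\,Q_{j+1,l}\mathbf{v}_{j+1}\quad(1\le j\le N-1).$$ The Robin transmission operator is $S_jv=-ip\,v$; the Schwarz iteration is $\mathbf{g}_n^{k+1}=\mathcal{R}_{h,n}\mathbf{g}_n^k$. *)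

theory Defs
  imports "HOL-Analysis.Analysis" "Jordan_Normal_Form.Matrix"
begin

hide_type (open) Finite_Cartesian_Product.vec
hide_const (open) Finite_Cartesian_Product.vec
unbundle no vec_syntax

text \<open>
  A one-dimensional mesh is given by its number \<open>K\<close> of nodes and the nodes
  \<open>xs 1 < ... < xs K\<close>, so that the meshed interval is \<open>{xs 1..xs K}\<close>. Nodes, basis functions and
  subdomains are numbered from 1; entries of matrices and vectors are numbered from 0.
\<close>

definition is_mesh :: "real \<Rightarrow> real \<Rightarrow> nat \<Rightarrow> (nat \<Rightarrow> real) \<Rightarrow> bool" where
  "is_mesh a b K xs \<longleftrightarrow>
     2 \<le> K \<and> xs 1 = a \<and> xs K = b \<and> (\<forall>\<alpha>. 1 \<le> \<alpha> \<and> \<alpha> < K \<longrightarrow> xs \<alpha> < xs (\<alpha> + 1))"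

definition hat :: "nat \<Rightarrow> (nat \<Rightarrow> real) \<Rightarrow> nat \<Rightarrow> real \<Rightarrow> real" where
  "hat K xs \<alpha> y =
     (if 1 < \<alpha> \<and> xs (\<alpha> - 1) \<le> y \<and> y \<le> xs \<alpha> then (y - xs (\<alpha> - 1)) / (xs \<alpha> - xs (\<alpha> - 1))
      else if \<alpha> < K \<and> xs \<alpha> \<le> y \<and> y \<le> xs (\<alpha> + 1) then (xs (\<alpha> + 1) - y) / (xs (\<alpha> + 1) - xs \<alpha>)
      else 0)"

definition mass_mat :: "nat \<Rightarrow> (nat \<Rightarrow> real) \<Rightarrow> complex mat" where
  "mass_mat K xs = mat K K (\<lambda>(\<alpha>, \<beta>). complex_of_real
     (integral {xs 1..xs K} (\<lambda>y. hat K xs (\<alpha> + 1) y * hat K xs (\<beta> + 1) y)))"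

text \<open>
  The basis functions are not differentiable at the nodes, where \<open>deriv\<close> has an unspecified value.
  This is a finite set and does not affect the integrals.
\<close>

definition stiffness_mat :: "nat \<Rightarrow> (nat \<Rightarrow> real) \<Rightarrow> complex mat" where
  "stiffness_mat K xs = mat K K (\<lambda>(\<alpha>, \<beta>). complex_of_real
     (integral {xs 1..xs K} (\<lambda>y. deriv (hat K xs (\<alpha> + 1)) y * deriv (hat K xs (\<beta> + 1)) y)))"

definition gen_mass_mat :: "nat \<Rightarrow> (nat \<Rightarrow> real) \<Rightarrow> (real \<Rightarrow> real) \<Rightarrow> complex mat" where
  "gen_mass_mat K xs W = mat K K (\<lambda>(\<alpha>, \<beta>). complex_of_real
     (integral {xs 1..xs K} (\<lambda>y. W y * hat K xs (\<alpha> + 1) y * hat K xs (\<beta> + 1) y)))"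

definition avg_potential :: "(real \<Rightarrow> real \<Rightarrow> real) \<Rightarrow> real \<Rightarrow> nat \<Rightarrow> real \<Rightarrow> real" where
  "avg_potential V dt n y = (V (real n * dt) y + V (real (n - 1) * dt) y) / 2"

definition interior_mat :: "real \<Rightarrow> nat \<Rightarrow> (nat \<Rightarrow> real) \<Rightarrow> (real \<Rightarrow> real) \<Rightarrow> complex mat" where
  "interior_mat dt K xs W =
     (2 * \<i> / complex_of_real dt) \<cdot>\<^sub>m mass_mat K xs - stiffness_mat K xs + gen_mass_mat K xs W"

definition Q_left :: "nat \<Rightarrow> complex vec" where
  "Q_left K = unit_vec K 0"

definition Q_right :: "nat \<Rightarrow> complex vec" where
  "Q_right K = unit_vec K (K - 1)"

definition Q_mat :: "nat \<Rightarrow> complex mat" where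
  "Q_mat K = mat_of_rows K [Q_left K, Q_right K]"

text \<open>
  Boundary matrix of subdomain \<open>j\<close> out of \<open>N\<close>: the left endpoint of the first subdomain and the
  right endpoint of the last one carry the homogeneous Neumann condition and are left out.
\<close>

definition boundary_mat :: "nat \<Rightarrow> nat \<Rightarrow> nat \<Rightarrow> complex mat" where
  "boundary_mat N K j = mat K K (\<lambda>(\<alpha>, \<beta>).
     if \<alpha> = \<beta> \<and> (\<alpha> = 0 \<and> j \<noteq> 1 \<or> \<alpha> = K - 1 \<and> j \<noteq> N) then 1 else 0)"

text \<open>
  Interface vectors \<open>(r\<^sub>1, l\<^sub>2, r\<^sub>2, \<dots>, l\<^sub>N\<^sub>-\<^sub>1, r\<^sub>N\<^sub>-\<^sub>1, l\<^sub>N)\<close> of dimension \<open>2 * N - 2\<close>: counting from 0,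
  \<open>r\<^sub>j\<close> is entry \<open>2 * j - 2\<close> and \<open>l\<^sub>j\<close> is entry \<open>2 * j - 3\<close>.
  The components \<open>l\<^sub>1\<close> and \<open>r\<^sub>N\<close>, which are not stored, are zero.
\<close>

definition l_comp :: "nat \<Rightarrow> complex vec \<Rightarrow> nat \<Rightarrow> complex" where
  "l_comp N g j = (if 2 \<le> j \<and> j \<le> N then g $ (2 * j - 3) else 0)"

definition r_comp :: "nat \<Rightarrow> complex vec \<Rightarrow> nat \<Rightarrow> complex" where
  "r_comp N g j = (if 1 \<le> j \<and> j \<le> N - 1 then g $ (2 * j - 2) else 0)"

definition interface_vec :: "nat \<Rightarrow> (nat \<Rightarrow> complex) \<Rightarrow> (nat \<Rightarrow> complex) \<Rightarrow> complex vec" where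
  "interface_vec N l r =
     vec (2 * N - 2) (\<lambda>i. if even i then r (i div 2 + 1) else l (i div 2 + 2))"

text \<open>
  \<open>K j\<close> and \<open>xs j\<close> are the mesh of subdomain \<open>j\<close>, \<open>W\<close> is the averaged potential of the time step,
  and \<open>u j\<close> is the vector of nodal values on subdomain \<open>j\<close> at the previous time step.
\<close>

definition local_sol ::
  "nat \<Rightarrow> (nat \<Rightarrow> nat) \<Rightarrow> (nat \<Rightarrow> nat \<Rightarrow> real) \<Rightarrow> real \<Rightarrow> real \<Rightarrow> (real \<Rightarrow> real) \<Rightarrow>
   (nat \<Rightarrow> complex vec) \<Rightarrow> complex vec \<Rightarrow> nat \<Rightarrow> complex vec" where
  "local_sol N K xs dt p W u g j =
     (THE v. v \<in> carrier_vec (K j) \<and>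
        (interior_mat dt (K j) (xs j) W + (\<i> * complex_of_real p) \<cdot>\<^sub>m boundary_mat N (K j) j) *\<^sub>v v =
        (2 * \<i> / complex_of_real dt) \<cdot>\<^sub>v (mass_mat (K j) (xs j) *\<^sub>v u j)
          - (boundary_mat N (K j) j * transpose_mat (Q_mat (K j))) *\<^sub>v
              vec_of_list [l_comp N g j, r_comp N g j])"

definition interface_op ::
  "nat \<Rightarrow> (nat \<Rightarrow> nat) \<Rightarrow> (nat \<Rightarrow> nat \<Rightarrow> real) \<Rightarrow> real \<Rightarrow> real \<Rightarrow> (real \<Rightarrow> real \<Rightarrow> real) \<Rightarrow> nat \<Rightarrow>
   (nat \<Rightarrow> complex vec) \<Rightarrow> complex vec \<Rightarrow> complex vec" where
  "interface_op N K xs dt p V n u g =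
     (let v = local_sol N K xs dt p (avg_potential V dt n) u g in
      interface_vec N
        (\<lambda>j. - r_comp N g (j - 1)
              - 2 * \<i> * complex_of_real p * scalar_prod (Q_right (K (j - 1))) (v (j - 1)))
        (\<lambda>j. - l_comp N g (j + 1)
              - 2 * \<i> * complex_of_real p * scalar_prod (Q_left (K (j + 1))) (v (j + 1))))"

definition interface_sparsity :: "nat \<Rightarrow> complex mat \<Rightarrow> bool" where
  "interface_sparsity N L \<longleftrightarrow>
     (\<exists>X :: nat \<Rightarrow> nat \<Rightarrow> complex. \<forall>g \<in> carrier_vec (2 * N - 2).
        (let l = l_comp N g; r = r_comp N g; l' = l_comp N (L *\<^sub>v g); r' = r_comp N (L *\<^sub>v g) in
          (\<forall>j. 1 \<le> j \<and> j \<le> N - 2 \<longrightarrow> r' j = X (j + 1) 1 * l (j + 1) + X (j + 1) 2 * r (j + 1)) \<and>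
          r' (N - 1) = X N 1 * l N \<and>
          l' 2 = X 1 4 * r 1 \<and>
          (\<forall>j. 3 \<le> j \<and> j \<le> N \<longrightarrow> l' j = X (j - 1) 3 * l (j - 1) + X (j - 1) 4 * r (j - 1))))"

end

theory Submission
  imports Defs "Jordan_Normal_Form.Determinant"
begin

text \<open>
  The Robin data \<open>l\<^sub>j, r\<^sub>j\<close> enter the local problem on subdomain \<open>j\<close> only linearly and only on
  its right-hand side. Hence, once the local matrix is known to be invertible, its solution is
  the response to the previous time level minus \<open>l\<^sub>j\<close> and \<open>r\<^sub>j\<close> times two fixed response
  vectors. The end values of these two responses, scaled by \<open>2ip\<close> and, where the incoming and
  outgoing data live at the same interface, shifted by \<open>-1\<close>, are the numbers \<open>x\<^sub>n\<^sup>j\<^sup>,\<^sup>s\<close>; the end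
  values of the response to the previous time level, times \<open>-2ip\<close>, form the translation \<open>d\<^sub>n\<close>. Neighbouring
  subdomains exchange end values, which is the asserted sparsity, and the absent components
  \<open>l\<^sub>1 = r\<^sub>N = 0\<close> shorten the two extreme rows.

  The analytic point is invertibility (\<open>injective_robin_mat\<close>). The local matrix is \<open>R + iP\<close>
  with real symmetric \<open>R\<close> (stiffness and potential) and \<open>P = (2/\<Delta>t) M + p M\<^sup>\<Gamma>\<close>. If
  \<open>(R + iP) v = 0\<close>, the imaginary part of \<open>v\<^sup>* (R + iP) v\<close> is \<open>v\<^sup>* P v\<close> and vanishes; so \<open>v = 0\<close>
  by positive definiteness of the mass matrix (\<open>mass_form_posdef\<close>). The potential may have any
  size and sign, as it contributes to \<open>R\<close> only.

  The response vectors depend on the time step through the matrix of the averaged potential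
  alone. For a time-independent potential these matrices coincide for all steps, hence so do the
  interface matrices.
\<close>

section \<open>Unique solvability from a positive definite imaginary part\<close>

definition injective_mat :: "complex mat \<Rightarrow> bool" where
  "injective_mat A \<longleftrightarrow>
     (\<forall>v\<in>carrier_vec (dim_col A). A *\<^sub>v v = 0\<^sub>v (dim_row A) \<longrightarrow> v = 0\<^sub>v (dim_col A))"

text \<open>
  A definite description rather than an inverse matrix, because the local solutions are given by
  exactly such a description.
\<close>

definition solve :: "complex mat \<Rightarrow> complex vec \<Rightarrow> complex vec" where
  "solve A b = (THE v. v \<in> carrier_vec (dim_col A) \<and> A *\<^sub>v v = b)"

text \<open>
  For \<open>v = x + iy\<close> in the kernel, the real part of the equation tested with \<open>y\<close> and the imaginary
  part tested with \<open>x\<close> give \<open>y\<^sup>T R x = y\<^sup>T P y\<close> and \<open>x\<^sup>T R y + x\<^sup>T P x = 0\<close>. By symmetry of \<open>R\<close>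
  the terms with \<open>R\<close> cancel and leave \<open>x\<^sup>T P x + y\<^sup>T P y = 0\<close>.
\<close>

lemma injective_mat_if_posdef_imaginary_part:
  fixes R P :: "nat \<Rightarrow> nat \<Rightarrow> real"
  assumes A: "A \<in> carrier_mat n n"
    and entry: "\<And>i k. i < n \<Longrightarrow> k < n \<Longrightarrow> A $$ (i, k) = Complex (R i k) (P i k)"
    and sym: "\<And>i k. i < n \<Longrightarrow> k < n \<Longrightarrow> R i k = R k i"
    and pos: "\<And>c. \<exists>i<n. c i \<noteq> 0 \<Longrightarrow> 0 < (\<Sum>i<n. \<Sum>k<n. c i * P i k * c k)"
  shows "injective_mat A"
  unfolding injective_mat_def
proof (intro ballI impI)
  fix v assume "v \<in> carrier_vec (dim_col A)" and Av: "A *\<^sub>v v = 0\<^sub>v (dim_row A)"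
  then have v: "v \<in> carrier_vec n"
    using A by simp
  define x where "x i = Re (v $ i)" for i
  define y where "y i = Im (v $ i)" for i
  define q where "q M c d = (\<Sum>i<n. \<Sum>k<n. c i * M i k * d k)" for M :: "nat \<Rightarrow> nat \<Rightarrow> real" and c d
  have row0: "(\<Sum>k<n. A $$ (i, k) * v $ k) = 0" if "i < n" for i
  proof -
    have "(A *\<^sub>v v) $ i = 0"
      using Av A that by simp
    then show ?thesis
      using that A v by (simp add: scalar_prod_def atLeast0LessThan)
  qed
  have "(\<Sum>k<n. R i k * x k - P i k * y k) = 0" if "i < n" for i
    using arg_cong[OF row0[OF that], of Re] that by (simp add: entry x_def y_def)
  then have "(\<Sum>i<n. y i * (\<Sum>k<n. R i k * x k - P i k * y k)) = 0"
    by simp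
  then have real_part: "q R y x = q P y y"
    by (simp add: q_def sum_distrib_left sum_subtractf algebra_simps)
  have "(\<Sum>k<n. R i k * y k + P i k * x k) = 0" if "i < n" for i
    using arg_cong[OF row0[OF that], of Im] that by (simp add: entry x_def y_def)
  then have "(\<Sum>i<n. x i * (\<Sum>k<n. R i k * y k + P i k * x k)) = 0"
    by simp
  then have imag_part: "q R x y + q P x x = 0"
    by (simp add: q_def sum_distrib_left sum.distrib algebra_simps)
  have "q R x y = q R y x"
    unfolding q_def by (subst sum.swap, intro sum.cong refl) (simp add: sym)
  with real_part imag_part have zero: "q P x x + q P y y = 0"
    by simp
  have nonneg: "0 \<le> q P c c" for c
  proof (cases "\<exists>i<n. c i \<noteq> 0")
    case True
    then show ?thesis
      using pos[of c] by (simp add: q_def)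
  qed (simp add: q_def)
  have "\<not> (\<exists>i<n. x i \<noteq> 0)" "\<not> (\<exists>i<n. y i \<noteq> 0)"
    using pos[of x] pos[of y] zero nonneg[of x] nonneg[of y] by (force simp: q_def)+
  then show "v = 0\<^sub>v (dim_col A)"
    using v A by (intro eq_vecI) (auto simp: x_def y_def complex_eq_iff)
qed

lemma solve_eqI:
  assumes A: "A \<in> carrier_mat n n" "injective_mat A" and w: "w \<in> carrier_vec n" "A *\<^sub>v w = b"
  shows "solve A b = w"
  unfolding solve_def
proof (rule the_equality)
  show "w \<in> carrier_vec (dim_col A) \<and> A *\<^sub>v w = b"
    using A w by simp
next
  fix v assume "v \<in> carrier_vec (dim_col A) \<and> A *\<^sub>v v = b"
  then have v: "v \<in> carrier_vec n" "A *\<^sub>v v = b"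
    using A by auto
  have "A *\<^sub>v (v - w) = b - b"
    using mult_minus_distrib_mat_vec[OF A(1) v(1) w(1)] v w by simp
  moreover have "b \<in> carrier_vec n"
    using A w by auto
  ultimately have "v - w = 0\<^sub>v n"
    using A v w unfolding injective_mat_def by auto
  then have "(v - w) $ i = 0" if "i < n" for i
    using that by simp
  then show "v = w"
    using v w by (intro eq_vecI) auto
qed

lemma solve_carrier_and_eq:
  assumes A: "A \<in> carrier_mat n n" "injective_mat A" and b: "b \<in> carrier_vec n"
  shows "solve A b \<in> carrier_vec n" "A *\<^sub>v solve A b = b"
proof -
  have "Determinant.det A \<noteq> 0"
    using A det_0_iff_vec_prod_zero_field[OF A(1)] by (auto simp: injective_mat_def)
  then obtain B where B: "B \<in> carrier_mat n n" "A * B = 1\<^sub>m n"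
    using det_non_zero_imp_unit[OF A(1)] unfolding Units_def ring_mat_def by auto
  have "A *\<^sub>v (B *\<^sub>v b) = (A * B) *\<^sub>v b"
    using assoc_mult_mat_vec[OF A(1) B(1) b] by simp
  then have "A *\<^sub>v (B *\<^sub>v b) = b"
    using B(2) b by simp
  moreover have "B *\<^sub>v b \<in> carrier_vec n"
    using B b by simp
  ultimately show "solve A b \<in> carrier_vec n" "A *\<^sub>v solve A b = b"
    using solve_eqI[OF A] by metis+
qed

lemma mult_mat_vec_two_columns:
  fixes C :: "complex mat"
  assumes "C \<in> carrier_mat n 2"
  shows "C *\<^sub>v vec_of_list [x, y] = x \<cdot>\<^sub>v col C 0 + y \<cdot>\<^sub>v col C (1 :: nat)"
  using assms
  by (intro eq_vecI)
     (auto simp: scalar_prod_def vec_of_list_index numeral_2_eq_2 mult.commute)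

text \<open>
  Superposition. The two columns of \<open>C\<close> will be the loads generated by a unit left and a unit
  right Robin datum.
\<close>

lemma solve_minus_two_columns:
  assumes A: "A \<in> carrier_mat n n" "injective_mat A"
    and b: "b \<in> carrier_vec n" and C: "C \<in> carrier_mat n 2"
  shows "solve A (b - C *\<^sub>v vec_of_list [x, y]) =
     solve A b - (x \<cdot>\<^sub>v solve A (col C 0) + y \<cdot>\<^sub>v solve A (col C 1))"
proof (rule solve_eqI[OF A])
  have cols: "col C 0 \<in> carrier_vec n" "col C 1 \<in> carrier_vec n"
    using C by auto
  note s = solve_carrier_and_eq[OF A b] solve_carrier_and_eq[OF A cols(1)]
    solve_carrier_and_eq[OF A cols(2)]
  show "solve A b - (x \<cdot>\<^sub>v solve A (col C 0) + y \<cdot>\<^sub>v solve A (col C 1)) \<in> carrier_vec n"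
    using s by simp
  have "A *\<^sub>v (x \<cdot>\<^sub>v solve A (col C 0) + y \<cdot>\<^sub>v solve A (col C 1)) = C *\<^sub>v vec_of_list [x, y]"
    unfolding mult_mat_vec_two_columns[OF C]
    using s A by (simp add: mult_add_distrib_mat_vec[OF A(1)] mult_mat_vec[OF A(1)])
  then show "A *\<^sub>v (solve A b - (x \<cdot>\<^sub>v solve A (col C 0) + y \<cdot>\<^sub>v solve A (col C 1))) =
      b - C *\<^sub>v vec_of_list [x, y]"
    using s by (simp add: mult_minus_distrib_mat_vec[OF A(1)])
qed

section \<open>Positive definiteness of the mass matrix\<close>

lemma is_mesh_strict_mono:
  assumes mesh: "is_mesh a b K xs" and "1 \<le> \<alpha>" "\<alpha> < \<beta>" "\<beta> \<le> K"
  shows "xs \<alpha> < xs \<beta>"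
proof -
  have "Suc \<alpha> \<le> \<beta>"
    using \<open>\<alpha> < \<beta>\<close> by simp
  then show ?thesis
    using \<open>\<beta> \<le> K\<close>
  proof (induction \<beta> rule: dec_induct)
    case base
    then show ?case
      using mesh \<open>1 \<le> \<alpha>\<close> by (auto simp: is_mesh_def)
  next
    case (step \<gamma>)
    then have "xs \<gamma> < xs (\<gamma> + 1)"
      using mesh by (auto simp: is_mesh_def)
    then show ?case
      using step by simp
  qed
qed

lemma is_mesh_bounds:
  assumes "is_mesh a b K xs"
  shows "xs 1 = a" "xs K = b" "a < b"
  using assms is_mesh_strict_mono[OF assms, of 1 K] by (auto simp: is_mesh_def)

lemma hat_at_node:
  assumes mesh: "is_mesh a b K xs" and "1 \<le> \<alpha>" "\<alpha> \<le> K" "1 \<le> \<beta>" "\<beta> \<le> K"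
  shows "hat K xs \<alpha> (xs \<beta>) = (if \<alpha> = \<beta> then 1 else 0)"
proof -
  note mono = is_mesh_strict_mono[OF mesh]
  have K: "2 \<le> K"
    using mesh by (simp add: is_mesh_def)
  consider "\<alpha> = \<beta>" | "\<beta> < \<alpha>" | "\<alpha> < \<beta>"
    by linarith
  then show ?thesis
  proof cases
    case 1
    show ?thesis
    proof (cases "1 < \<alpha>")
      case True
      then have "xs (\<alpha> - 1) < xs \<alpha>"
        using mono[of "\<alpha> - 1" \<alpha>] assms by simp
      then show ?thesis
        using True 1 by (simp add: hat_def)
    next
      case False
      then have "\<alpha> < K"
        using K assms by simp
      then have "xs \<alpha> < xs (\<alpha> + 1)"
        using mono[of \<alpha> "\<alpha> + 1"] assms by simp
      then show ?thesis
        using False \<open>\<alpha> < K\<close> 1 by (simp add: hat_def)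
    qed
  next
    case 2
    then have "xs \<beta> < xs \<alpha>"
      using mono[of \<beta> \<alpha>] assms by simp
    moreover have "\<beta> = \<alpha> - 1 \<or> xs \<beta> < xs (\<alpha> - 1)"
      using mono[of \<beta> "\<alpha> - 1"] assms 2 by (cases "\<beta> = \<alpha> - 1") auto
    ultimately show ?thesis
      using 2 unfolding hat_def by (auto split: if_splits)
  next
    case 3
    then have "xs \<alpha> < xs \<beta>"
      using mono[of \<alpha> \<beta>] assms by simp
    moreover have "\<beta> = \<alpha> + 1 \<or> xs (\<alpha> + 1) < xs \<beta>"
      using mono[of "\<alpha> + 1" \<beta>] assms 3 by (cases "\<beta> = \<alpha> + 1") auto
    ultimately show ?thesis
      using 3 unfolding hat_def by (auto split: if_splits)
  qed
qed

text \<open>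
  On the meshed interval a hat function is the positive part of the smaller of its two linear
  branches; at an end node the missing branch is replaced by 1, which bounds the other
  branch on the interval. This makes continuity evident, which the piecewise definition does not.
\<close>

lemma hat_closed_form:
  assumes mesh: "is_mesh a b K xs" and "1 \<le> \<alpha>" "\<alpha> \<le> K" and y: "a \<le> y" "y \<le> b"
  shows "hat K xs \<alpha> y = max 0 (min
     (if 1 < \<alpha> then (y - xs (\<alpha> - 1)) / (xs \<alpha> - xs (\<alpha> - 1)) else 1)
     (if \<alpha> < K then (xs (\<alpha> + 1) - y) / (xs (\<alpha> + 1) - xs \<alpha>) else 1))"
proof -
  have left: "xs (\<alpha> - 1) < xs \<alpha>" if "1 < \<alpha>"
    using that assms is_mesh_strict_mono[OF mesh, of "\<alpha> - 1" \<alpha>] by simp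
  have right: "xs \<alpha> < xs (\<alpha> + 1)" if "\<alpha> < K"
    using that assms is_mesh_strict_mono[OF mesh, of \<alpha> "\<alpha> + 1"] by simp
  have first: "xs \<alpha> \<le> y" if "\<not> 1 < \<alpha>"
    using that assms is_mesh_bounds[OF mesh] by (auto simp: not_less)
  have last: "y \<le> xs \<alpha>" if "\<not> \<alpha> < K"
    using that assms is_mesh_bounds[OF mesh] by auto
  define u where "u = (y - xs (\<alpha> - 1)) / (xs \<alpha> - xs (\<alpha> - 1))"
  define w where "w = (xs (\<alpha> + 1) - y) / (xs (\<alpha> + 1) - xs \<alpha>)"
  have u: "xs (\<alpha> - 1) \<le> y \<longleftrightarrow> 0 \<le> u" "y \<le> xs \<alpha> \<longleftrightarrow> u \<le> 1" "xs \<alpha> \<le> y \<longleftrightarrow> 1 \<le> u" if "1 < \<alpha>"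
    using left[OF that] by (simp_all add: u_def field_simps)
  have w: "xs \<alpha> \<le> y \<longleftrightarrow> w \<le> 1" "y \<le> xs (\<alpha> + 1) \<longleftrightarrow> 0 \<le> w" "y \<le> xs \<alpha> \<longleftrightarrow> 1 \<le> w" if "\<alpha> < K"
    using right[OF that] by (simp_all add: w_def field_simps)
  consider "1 < \<alpha>" "y \<le> xs \<alpha>" | "\<alpha> < K" "xs \<alpha> \<le> y" "\<not> (1 < \<alpha> \<and> y \<le> xs \<alpha>)"
    using first last mesh by (cases "y \<le> xs \<alpha>") (auto simp: is_mesh_def)
  then show ?thesis
  proof cases
    case 1
    have "min u (if \<alpha> < K then w else 1) = u"
      using u(2)[OF 1(1)] w(3) 1 by (cases "\<alpha> < K") (auto simp: min_def)
    moreover have "hat K xs \<alpha> y = max 0 u"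
    proof (cases "xs (\<alpha> - 1) \<le> y")
      case True
      then show ?thesis
        using 1 u(1)[OF 1(1)] by (simp add: hat_def u_def)
    next
      case False
      then have "\<not> xs \<alpha> \<le> y"
        using left[OF 1(1)] by simp
      then show ?thesis
        using False u(1)[OF 1(1)] by (simp add: hat_def)
    qed
    ultimately show ?thesis
      using 1 unfolding u_def w_def by simp
  next
    case 2
    have "min (if 1 < \<alpha> then u else 1) w = w"
      using w(1)[OF 2(1)] u(3) 2 by (cases "1 < \<alpha>") (auto simp: min_def)
    moreover have "hat K xs \<alpha> y = max 0 w"
    proof (cases "y \<le> xs (\<alpha> + 1)")
      case True
      then have "0 \<le> w"
        using w(2)[OF 2(1)] by simp
      moreover have "hat K xs \<alpha> y = w"
        using True 2 by (auto simp: hat_def w_def)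
      ultimately show ?thesis
        by simp
    next
      case False
      then have "w < 0"
        using w(2)[OF 2(1)] by simp
      moreover have "hat K xs \<alpha> y = 0"
        using False 2 by (auto simp: hat_def)
      ultimately show ?thesis
        by simp
    qed
    ultimately show ?thesis
      using 2 unfolding u_def w_def by simp
  qed
qed

lemma continuous_on_hat:
  assumes mesh: "is_mesh a b K xs" and "1 \<le> \<alpha>" "\<alpha> \<le> K"
  shows "continuous_on {a..b} (hat K xs \<alpha>)"
proof -
  have left: "xs \<alpha> - xs (\<alpha> - 1) \<noteq> 0" if "1 < \<alpha>"
    using that assms is_mesh_strict_mono[OF mesh, of "\<alpha> - 1" \<alpha>] by force
  have right: "xs (\<alpha> + 1) - xs \<alpha> \<noteq> 0" if "\<alpha> < K"
    using that assms is_mesh_strict_mono[OF mesh, of \<alpha> "\<alpha> + 1"] by simp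
  have "continuous_on {a..b} (\<lambda>y. max 0 (min
     (if 1 < \<alpha> then (y - xs (\<alpha> - 1)) / (xs \<alpha> - xs (\<alpha> - 1)) else 1)
     (if \<alpha> < K then (xs (\<alpha> + 1) - y) / (xs (\<alpha> + 1) - xs \<alpha>) else 1)))"
    using left right
    by (cases "1 < \<alpha>"; cases "\<alpha> < K"; simp only: if_True if_False;
        intro continuous_intros) auto
  then show ?thesis
    by (rule continuous_on_eq) (use hat_closed_form[OF assms] in auto)
qed

text \<open>
  The form is the integral of \<open>s\<^sup>2\<close> for the finite element function \<open>s\<close> with nodal values \<open>c\<close>.
  A continuous nonnegative function with vanishing integral is zero, and so are its nodal values.
\<close>

lemma mass_form_posdef:
  assumes mesh: "is_mesh a b K xs" and nz: "\<exists>i<K. c i \<noteq> 0"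
  shows "0 < (\<Sum>i<K. \<Sum>k<K.
     c i * integral {xs 1..xs K} (\<lambda>y. hat K xs (i + 1) y * hat K xs (k + 1) y) * c k)"
proof -
  define s where "s y = (\<Sum>i<K. c i * hat K xs (i + 1) y)" for y
  note ends = is_mesh_bounds[OF mesh]
  have cont: "continuous_on {a..b} (hat K xs (i + 1))" if "i < K" for i
    using continuous_on_hat[OF mesh, of "i + 1"] that by simp
  then have cont_s: "continuous_on {a..b} (\<lambda>y. s y * s y)"
    unfolding s_def by (intro continuous_intros) auto
  have int: "(\<lambda>y. hat K xs (i + 1) y * hat K xs (k + 1) y) integrable_on {a..b}"
    if "i < K" "k < K" for i k
    by (intro integrable_continuous_real continuous_on_mult cont that)
  have "((\<lambda>y. \<Sum>i<K. \<Sum>k<K. (c i * c k) * (hat K xs (i + 1) y * hat K xs (k + 1) y)) has_integral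
      (\<Sum>i<K. \<Sum>k<K. (c i * c k) *
        integral {a..b} (\<lambda>y. hat K xs (i + 1) y * hat K xs (k + 1) y))) {a..b}"
    by (intro has_integral_sum has_integral_mult_right integrable_integral int finite_lessThan) simp_all
  moreover have "(\<Sum>i<K. \<Sum>k<K. (c i * c k) * (hat K xs (i + 1) y * hat K xs (k + 1) y)) = s y * s y"
    for y
    by (simp only: s_def sum_product ac_simps)
  moreover have "(\<Sum>i<K. \<Sum>k<K. (c i * c k) *
        integral {a..b} (\<lambda>y. hat K xs (i + 1) y * hat K xs (k + 1) y)) = (\<Sum>i<K. \<Sum>k<K.
      c i * integral {a..b} (\<lambda>y. hat K xs (i + 1) y * hat K xs (k + 1) y) * c k)"
    by (intro sum.cong refl) (simp only: ac_simps)
  ultimately have eq: "(\<Sum>i<K. \<Sum>k<K.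
      c i * integral {a..b} (\<lambda>y. hat K xs (i + 1) y * hat K xs (k + 1) y) * c k)
    = integral {a..b} (\<lambda>y. s y * s y)"
    by (simp add: integral_unique)
  obtain i where i: "i < K" "c i \<noteq> 0"
    using nz by blast
  have "s (xs (i + 1)) = (\<Sum>k<K. if k = i then c k else 0)"
    unfolding s_def by (intro sum.cong refl) (use i hat_at_node[OF mesh] in auto)
  then have "s (xs (i + 1)) \<noteq> 0"
    using i by simp
  moreover have "xs (i + 1) \<in> {a..b}"
    using i is_mesh_strict_mono[OF mesh, of 1 "i + 1"] is_mesh_strict_mono[OF mesh, of "i + 1" K] ends
    by (cases "i = 0"; cases "i + 1 = K") auto
  ultimately have "integral {a..b} (\<lambda>y. s y * s y) \<noteq> 0"
    using integral_eq_0_iff[OF cont_s] ends by auto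
  moreover have "0 \<le> integral {a..b} (\<lambda>y. s y * s y)"
    by (intro integral_nonneg integrable_continuous_real cont_s) auto
  ultimately show ?thesis
    using eq ends by simp
qed

section \<open>The local Robin problems\<close>

definition robin_mat :: "nat \<Rightarrow> (nat \<Rightarrow> nat) \<Rightarrow> (nat \<Rightarrow> nat \<Rightarrow> real) \<Rightarrow> real \<Rightarrow> real \<Rightarrow>
    (real \<Rightarrow> real) \<Rightarrow> nat \<Rightarrow> complex mat" where
  "robin_mat N K xs dt p W j =
     interior_mat dt (K j) (xs j) W + (\<i> * complex_of_real p) \<cdot>\<^sub>m boundary_mat N (K j) j"

definition robin_load :: "nat \<Rightarrow> (nat \<Rightarrow> nat) \<Rightarrow> nat \<Rightarrow> complex mat" where
  "robin_load N K j = boundary_mat N (K j) j * transpose_mat (Q_mat (K j))"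

lemma mass_mat_carrier: "mass_mat k x \<in> carrier_mat k k"
  by (simp add: mass_mat_def)

lemma robin_mat_carrier [simp]: "robin_mat N K xs dt p W j \<in> carrier_mat (K j) (K j)"
  by (simp add: robin_mat_def interior_mat_def mass_mat_def stiffness_mat_def gen_mass_mat_def
      boundary_mat_def)

lemma robin_load_carrier [simp]: "robin_load N K j \<in> carrier_mat (K j) 2"
  unfolding robin_load_def
  by (rule mult_carrier_mat[of _ _ "K j"]) (auto simp: boundary_mat_def Q_mat_def)

text \<open>
  The boundary matrix has a nonnegative diagonal, so it can only help the mass matrix: the extreme
  subdomains, where part of it is missing, need no separate treatment.
\<close>

lemma injective_robin_mat:
  assumes mesh: "is_mesh a b (K j) (xs j)" and "0 < dt" "0 < p"
  shows "injective_mat (robin_mat N K xs dt p W j)"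
proof -
  let ?h = "\<lambda>i. hat (K j) (xs j) (i + 1)"
  let ?I = "\<lambda>f. integral {xs j 1..xs j (K j)} f"
  define M where "M i k = ?I (\<lambda>y. ?h i y * ?h k y)" for i k
  define R where "R i k = ?I (\<lambda>y. W y * ?h i y * ?h k y) - ?I (\<lambda>y. deriv (?h i) y * deriv (?h k) y)"
    for i k
  define B :: "nat \<Rightarrow> real"
    where "B i = (if i = 0 \<and> j \<noteq> 1 \<or> i = K j - 1 \<and> j \<noteq> N then 1 else 0)" for i
  define P where "P i k = 2 / dt * M i k + (if i = k then p * B i else 0)" for i k
  show ?thesis
  proof (rule injective_mat_if_posdef_imaginary_part[OF robin_mat_carrier, where R = R and P = P])
    fix i k assume "i < K j" "k < K j"
    then show "robin_mat N K xs dt p W j $$ (i, k) = Complex (R i k) (P i k)"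
      by (simp add: robin_mat_def interior_mat_def mass_mat_def stiffness_mat_def gen_mass_mat_def
          boundary_mat_def complex_eq_iff R_def P_def M_def B_def)
  next
    fix i k show "R i k = R k i"
        by (simp add: R_def mult_ac)
  next
    fix c :: "nat \<Rightarrow> real" assume nz: "\<exists>i<K j. c i \<noteq> 0"
    have "(\<Sum>i<K j. \<Sum>k<K j. c i * P i k * c k) =
        (\<Sum>i<K j. \<Sum>k<K j. 2 / dt * (c i * M i k * c k) + (if i = k then c i * (p * B i) * c k else 0))"
      by (intro sum.cong refl) (auto simp: P_def algebra_simps)
    also have "\<dots> = 2 / dt * (\<Sum>i<K j. \<Sum>k<K j. c i * M i k * c k) +
        (\<Sum>i<K j. p * B i * (c i)\<^sup>2)"
      by (simp add: sum.distrib sum_distrib_left power2_eq_square mult_ac)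
    finally have eq: "(\<Sum>i<K j. \<Sum>k<K j. c i * P i k * c k) =
        2 / dt * (\<Sum>i<K j. \<Sum>k<K j. c i * M i k * c k) + (\<Sum>i<K j. p * B i * (c i)\<^sup>2)" .
    have "0 < 2 / dt * (\<Sum>i<K j. \<Sum>k<K j. c i * M i k * c k)"
      using mass_form_posdef[OF mesh nz] \<open>0 < dt\<close> by (simp add: M_def)
    moreover have "0 \<le> (\<Sum>i<K j. p * B i * (c i)\<^sup>2)"
      using \<open>0 < p\<close> by (intro sum_nonneg) (simp add: B_def)
    ultimately show "0 < (\<Sum>i<K j. \<Sum>k<K j. c i * P i k * c k)"
      using eq by linarith
  qed
qed

lemma local_sol_eq_superposition:
  fixes N :: nat and W :: "real \<Rightarrow> real"
  assumes mesh: "is_mesh a b (K j) (xs j)" and "0 < dt" "0 < p" and u: "u j \<in> carrier_vec (K j)"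
  defines "A \<equiv> robin_mat N K xs dt p W j" and "C \<equiv> robin_load N K j"
  shows "local_sol N K xs dt p W u g j =
     solve A ((2 * \<i> / complex_of_real dt) \<cdot>\<^sub>v (mass_mat (K j) (xs j) *\<^sub>v u j)) -
     (l_comp N g j \<cdot>\<^sub>v solve A (col C 0) + r_comp N g j \<cdot>\<^sub>v solve A (col C 1))"
proof -
  have A: "A \<in> carrier_mat (K j) (K j)" "injective_mat A"
    using injective_robin_mat[of a b K j xs, OF mesh \<open>0 < dt\<close> \<open>0 < p\<close>] by (simp_all add: A_def)
  have "mass_mat (K j) (xs j) *\<^sub>v u j \<in> carrier_vec (K j)"
    by (rule mult_mat_vec_carrier[OF mass_mat_carrier u])
  then have F: "(2 * \<i> / complex_of_real dt) \<cdot>\<^sub>v (mass_mat (K j) (xs j) *\<^sub>v u j) \<in> carrier_vec (K j)"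
    by simp
  have "local_sol N K xs dt p W u g j =
     solve A ((2 * \<i> / complex_of_real dt) \<cdot>\<^sub>v (mass_mat (K j) (xs j) *\<^sub>v u j) -
       C *\<^sub>v vec_of_list [l_comp N g j, r_comp N g j])"
    unfolding local_sol_def solve_def carrier_matD(2)[OF A(1)]
      robin_mat_def[symmetric] robin_load_def[symmetric] A_def[symmetric] C_def[symmetric] ..
  then show ?thesis
    using solve_minus_two_columns[OF A F] by (simp add: C_def)
qed

text \<open>
  Finitely many exceptional points are allowed because a potential known to be time-independent
  on the open domain may still vary in time at the two end points of the domain.
\<close>

lemma robin_mat_cong:
  assumes "finite S" "\<And>y. y \<in> {xs j 1..xs j (K j)} - S \<Longrightarrow> W y = W' y"
  shows "robin_mat N K xs dt p W j = robin_mat N K xs dt p W' j"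
proof -
  have "gen_mass_mat (K j) (xs j) W = gen_mass_mat (K j) (xs j) W'"
    unfolding gen_mass_mat_def
    by (intro cong_mat refl) (auto intro!: integral_spike[of S] negligible_finite assms simp: assms(2))
  then show ?thesis
    by (simp add: robin_mat_def interior_mat_def)
qed

section \<open>The interface matrix\<close>

text \<open>
  The row vectors that extract \<open>l\<^sub>j\<close> and \<open>r\<^sub>j\<close> from an interface vector. They are zero where the
  component is not stored, so that all rows of the interface matrix obey one formula.
\<close>

definition l_row :: "nat \<Rightarrow> nat \<Rightarrow> complex vec" where
  "l_row N j = (if 2 \<le> j \<and> j \<le> N then unit_vec (2 * N - 2) (2 * j - 3) else 0\<^sub>v (2 * N - 2))"

definition r_row :: "nat \<Rightarrow> nat \<Rightarrow> complex vec" where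
  "r_row N j = (if 1 \<le> j \<and> j \<le> N - 1 then unit_vec (2 * N - 2) (2 * j - 2) else 0\<^sub>v (2 * N - 2))"

text \<open>
  Row \<open>i\<close> produces \<open>r\<^sub>j\<close> with \<open>j = i/2 + 1\<close> for even \<open>i\<close> and \<open>l\<^sub>j\<close> with \<open>j = (i - 1)/2 + 2\<close> for odd
  \<open>i\<close>; the former is fed by subdomain \<open>j + 1\<close>, the latter by subdomain \<open>j - 1\<close>.
\<close>

definition interface_mat :: "nat \<Rightarrow> (nat \<Rightarrow> nat \<Rightarrow> complex) \<Rightarrow> complex mat" where
  "interface_mat N X = mat\<^sub>r (2 * N - 2) (2 * N - 2) (\<lambda>i.
     if even i then X (i div 2 + 2) 1 \<cdot>\<^sub>v l_row N (i div 2 + 2) + X (i div 2 + 2) 2 \<cdot>\<^sub>v r_row N (i div 2 + 2)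
     else X (i div 2 + 1) 3 \<cdot>\<^sub>v l_row N (i div 2 + 1) + X (i div 2 + 1) 4 \<cdot>\<^sub>v r_row N (i div 2 + 1))"

text \<open>
  \<open>w 0\<close> and \<open>w 1\<close> are the responses of subdomain \<open>j\<close> to a unit left and a unit right datum. The load
  carries a minus sign, which cancels the one in \<open>-2ip\<close>. The \<open>-1\<close> comes from the incoming datum
  that is subtracted at the same end point: \<open>l\<^sub>j\<close> at the left (\<open>s = 1\<close>), \<open>r\<^sub>j\<close> at the right (\<open>s = 4\<close>).
\<close>

definition transmission_coeff :: "nat \<Rightarrow> (nat \<Rightarrow> nat) \<Rightarrow> (nat \<Rightarrow> nat \<Rightarrow> real) \<Rightarrow> real \<Rightarrow> real \<Rightarrow>
    (real \<Rightarrow> real) \<Rightarrow> nat \<Rightarrow> nat \<Rightarrow> complex" where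
  "transmission_coeff N K xs dt p W j s =
     (let w = (\<lambda>k. solve (robin_mat N K xs dt p W j) (col (robin_load N K j) k)) in
      if s = 1 then 2 * \<i> * complex_of_real p * scalar_prod (Q_left (K j)) (w 0) - 1
      else if s = 2 then 2 * \<i> * complex_of_real p * scalar_prod (Q_left (K j)) (w 1)
      else if s = 3 then 2 * \<i> * complex_of_real p * scalar_prod (Q_right (K j)) (w 0)
      else 2 * \<i> * complex_of_real p * scalar_prod (Q_right (K j)) (w 1) - 1)"

lemma l_row_carrier [simp]: "l_row N j \<in> carrier_vec (2 * N - 2)"
  and r_row_carrier [simp]: "r_row N j \<in> carrier_vec (2 * N - 2)"
  by (simp_all add: l_row_def r_row_def)

lemma l_row_scalar_prod: "g \<in> carrier_vec (2 * N - 2) \<Longrightarrow> scalar_prod (l_row N j) g = l_comp N g j"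
  by (auto simp: l_row_def l_comp_def scalar_prod_left_unit)

lemma r_row_scalar_prod: "g \<in> carrier_vec (2 * N - 2) \<Longrightarrow> scalar_prod (r_row N j) g = r_comp N g j"
  by (auto simp: r_row_def r_comp_def scalar_prod_left_unit)

lemma interface_mat_carrier [simp]: "interface_mat N X \<in> carrier_mat (2 * N - 2) (2 * N - 2)"
  by (simp add: interface_mat_def)

lemma interface_vec_carrier [simp]: "interface_vec N l r \<in> carrier_vec (2 * N - 2)"
  by (simp add: interface_vec_def)

lemma interface_mat_mult_vec:
  assumes g: "g \<in> carrier_vec (2 * N - 2)"
  shows "interface_mat N X *\<^sub>v g = interface_vec N
    (\<lambda>j. X (j - 1) 3 * l_comp N g (j - 1) + X (j - 1) 4 * r_comp N g (j - 1))
    (\<lambda>j. X (j + 1) 1 * l_comp N g (j + 1) + X (j + 1) 2 * r_comp N g (j + 1))"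
proof (rule eq_vecI)
  have comb: "scalar_prod (x \<cdot>\<^sub>v l_row N j + y \<cdot>\<^sub>v r_row N j) g = x * l_comp N g j + y * r_comp N g j"
    for x y j
    using g by (simp add: add_scalar_prod_distrib[of _ "2 * N - 2"] l_row_scalar_prod r_row_scalar_prod
        smult_scalar_prod_distrib[of _ "2 * N - 2"])
  fix i assume "i < dim_vec (interface_vec N
    (\<lambda>j. X (j - 1) 3 * l_comp N g (j - 1) + X (j - 1) 4 * r_comp N g (j - 1))
    (\<lambda>j. X (j + 1) 1 * l_comp N g (j + 1) + X (j + 1) 2 * r_comp N g (j + 1)))"
  then have "i < 2 * N - 2"
    by (simp add: interface_vec_def)
  moreover have "dim_vec (x \<cdot>\<^sub>v l_row N j + y \<cdot>\<^sub>v r_row N j) = 2 * N - 2" for x y j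
    by (simp add: r_row_def)
  ultimately show "(interface_mat N X *\<^sub>v g) $ i = interface_vec N
    (\<lambda>j. X (j - 1) 3 * l_comp N g (j - 1) + X (j - 1) 4 * r_comp N g (j - 1))
    (\<lambda>j. X (j + 1) 1 * l_comp N g (j + 1) + X (j + 1) 2 * r_comp N g (j + 1)) $ i"
    by (auto simp: interface_mat_def interface_vec_def comb)
qed (simp add: interface_mat_def interface_vec_def)

lemma l_comp_interface_vec: "2 \<le> j \<Longrightarrow> j \<le> N \<Longrightarrow> l_comp N (interface_vec N l r) j = l j"
proof -
  assume j: "2 \<le> j" "j \<le> N"
  then obtain k where k: "j = k + 2"
    by (metis add.commute le_Suc_ex)
  then have "2 * j - 3 = 2 * k + 1"
    by simp
  with j k show ?thesis
    by (simp add: l_comp_def interface_vec_def)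
qed

lemma r_comp_interface_vec: "1 \<le> j \<Longrightarrow> j \<le> N - 1 \<Longrightarrow> r_comp N (interface_vec N l r) j = r j"
proof -
  assume j: "1 \<le> j" "j \<le> N - 1"
  then obtain k where k: "j = k + 1"
    by (metis add.commute le_Suc_ex)
  then have "2 * j - 2 = 2 * k"
    by simp
  with j k show ?thesis
    by (simp add: r_comp_def interface_vec_def)
qed

lemma interface_sparsity_interface_mat:
  assumes "2 \<le> N"
  shows "interface_sparsity N (interface_mat N X)"
  unfolding interface_sparsity_def Let_def
proof (intro exI[of _ X] ballI)
  fix g :: "complex vec" assume g: "g \<in> carrier_vec (2 * N - 2)"
  have absent: "l_comp N g 1 = 0" "r_comp N g N = 0"
    using assms by (auto simp: l_comp_def r_comp_def)
  have last: "N - 1 + 1 = N"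
    using assms by simp
  show "(\<forall>j. 1 \<le> j \<and> j \<le> N - 2 \<longrightarrow> r_comp N (interface_mat N X *\<^sub>v g) j =
      X (j + 1) 1 * l_comp N g (j + 1) + X (j + 1) 2 * r_comp N g (j + 1)) \<and>
    r_comp N (interface_mat N X *\<^sub>v g) (N - 1) = X N 1 * l_comp N g N \<and>
    l_comp N (interface_mat N X *\<^sub>v g) 2 = X 1 4 * r_comp N g 1 \<and>
    (\<forall>j. 3 \<le> j \<and> j \<le> N \<longrightarrow> l_comp N (interface_mat N X *\<^sub>v g) j =
      X (j - 1) 3 * l_comp N g (j - 1) + X (j - 1) 4 * r_comp N g (j - 1))"
    unfolding interface_mat_mult_vec[OF g]
    using assms absent last by (auto simp: l_comp_interface_vec r_comp_interface_vec)
qed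

lemma interface_mat_cong:
  assumes "\<And>j. 1 \<le> j \<Longrightarrow> j \<le> N \<Longrightarrow> X j = Y j"
  shows "interface_mat N X = interface_mat N Y"
proof -
  have "X (i div 2 + 2) = Y (i div 2 + 2)" "X (i div 2 + 1) = Y (i div 2 + 1)" if "i < 2 * N - 2" for i
    using that by (auto intro!: assms)
  then show ?thesis
    unfolding interface_mat_def by (intro eq_matI) auto
qed

lemma interface_vec_cong:
  assumes "\<And>j. 2 \<le> j \<Longrightarrow> j \<le> N \<Longrightarrow> l j = l' j" "\<And>j. 1 \<le> j \<Longrightarrow> j \<le> N - 1 \<Longrightarrow> r j = r' j"
  shows "interface_vec N l r = interface_vec N l' r'"
proof (rule eq_vecI)
  fix i assume "i < dim_vec (interface_vec N l' r')"
  then have i: "i < 2 * N - 2"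
    by (simp add: interface_vec_def)
  then have "i div 2 + 1 \<le> N - 1"
    by linarith
  then show "interface_vec N l r $ i = interface_vec N l' r' $ i"
    using i assms(1)[of "i div 2 + 2"] assms(2)[of "i div 2 + 1"] by (simp add: interface_vec_def)
qed (simp add: interface_vec_def)

section \<open>Affine structure of the interface operator\<close>

text \<open>
  Superposition is applied to the traces of the local solutions: \<open>trace\<close> below is the only place
  where unique solvability enters, and it yields both the coefficients and the translation \<open>d\<close>.
\<close>

lemma interface_op_affine:
  assumes N: "2 \<le> N" and "0 < dt" "0 < p"
    and mesh: "\<And>j. 1 \<le> j \<Longrightarrow> j \<le> N \<Longrightarrow> is_mesh (a j) (b j) (K j) (xs j)"
    and u: "\<And>j. 1 \<le> j \<Longrightarrow> j \<le> N \<Longrightarrow> u j \<in> carrier_vec (K j)"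
  shows "\<exists>d\<in>carrier_vec (2 * N - 2). \<forall>g\<in>carrier_vec (2 * N - 2).
    interface_op N K xs dt p V n u g =
      interface_mat N (transmission_coeff N K xs dt p (avg_potential V dt n)) *\<^sub>v g + d"
proof -
  define W where "W = avg_potential V dt n"
  define X where "X = transmission_coeff N K xs dt p W"
  define z where "z = 2 * \<i> * complex_of_real p"
  define A where "A = robin_mat N K xs dt p W"
  define w0 where "w0 j = solve (A j) ((2 * \<i> / complex_of_real dt) \<cdot>\<^sub>v (mass_mat (K j) (xs j) *\<^sub>v u j))" for j
  define w where "w k j = solve (A j) (col (robin_load N K j) k)" for k j
  have X: "X j 1 = z * scalar_prod (Q_left (K j)) (w 0 j) - 1"
    "X j 2 = z * scalar_prod (Q_left (K j)) (w 1 j)"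
    "X j 3 = z * scalar_prod (Q_right (K j)) (w 0 j)"
    "X j 4 = z * scalar_prod (Q_right (K j)) (w 1 j) - 1" for j
    by (simp_all add: X_def transmission_coeff_def z_def w_def A_def)
  have trace: "scalar_prod q (local_sol N K xs dt p W u g j) = scalar_prod q (w0 j) -
      (l_comp N g j * scalar_prod q (w 0 j) + r_comp N g j * scalar_prod q (w 1 j))"
    if j: "1 \<le> j" "j \<le> N" and q: "q \<in> carrier_vec (K j)" for q g j
  proof -
    have A: "A j \<in> carrier_mat (K j) (K j)" "injective_mat (A j)"
      using injective_robin_mat[of "a j" "b j" K j xs, OF mesh[OF j] \<open>0 < dt\<close> \<open>0 < p\<close>] by (simp_all add: A_def)
    have "mass_mat (K j) (xs j) *\<^sub>v u j \<in> carrier_vec (K j)"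
      by (rule mult_mat_vec_carrier[OF mass_mat_carrier u[OF j]])
    then have w0: "w0 j \<in> carrier_vec (K j)"
      unfolding w0_def by (intro solve_carrier_and_eq[OF A]) simp
    have w: "w k j \<in> carrier_vec (K j)" for k
      unfolding w_def
      by (intro solve_carrier_and_eq[OF A]) (metis robin_load_carrier carrier_matD(1) col_dim)
    have "local_sol N K xs dt p W u g j =
        w0 j - (l_comp N g j \<cdot>\<^sub>v w 0 j + r_comp N g j \<cdot>\<^sub>v w 1 j)"
      using local_sol_eq_superposition[of "a j" "b j" K j xs dt p u, OF mesh[OF j] \<open>0 < dt\<close> \<open>0 < p\<close> u[OF j]]
      by (simp add: w0_def w_def A_def)
    then show ?thesis
      using q w0 w by (simp add: scalar_prod_minus_distrib[of _ "K j"] scalar_prod_add_distrib[of _ "K j"])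
  qed
  have Q: "Q_left k \<in> carrier_vec k" "Q_right k \<in> carrier_vec k" for k
    by (simp_all add: Q_left_def Q_right_def)
  define d where "d = interface_vec N
    (\<lambda>j. - z * scalar_prod (Q_right (K (j - 1))) (w0 (j - 1)))
    (\<lambda>j. - z * scalar_prod (Q_left (K (j + 1))) (w0 (j + 1)))"
  have "interface_op N K xs dt p V n u g = interface_mat N X *\<^sub>v g + d"
    if g: "g \<in> carrier_vec (2 * N - 2)" for g
  proof -
    have "interface_op N K xs dt p V n u g = interface_vec N
      (\<lambda>j. (X (j - 1) 3 * l_comp N g (j - 1) + X (j - 1) 4 * r_comp N g (j - 1))
         + - z * scalar_prod (Q_right (K (j - 1))) (w0 (j - 1)))
      (\<lambda>j. (X (j + 1) 1 * l_comp N g (j + 1) + X (j + 1) 2 * r_comp N g (j + 1))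
         + - z * scalar_prod (Q_left (K (j + 1))) (w0 (j + 1)))"
      unfolding interface_op_def Let_def W_def[symmetric] z_def[symmetric]
      by (intro interface_vec_cong) (simp_all add: trace Q X X(1)[unfolded One_nat_def] algebra_simps)
    also have "\<dots> = interface_mat N X *\<^sub>v g + d"
      unfolding interface_mat_mult_vec[OF g] d_def
      by (rule eq_vecI) (auto simp: interface_vec_def)
    finally show ?thesis .
  qed
  then show ?thesis
    by (intro bexI[of _ d]) (auto simp: X_def W_def d_def)
qed

section \<open>Independence of the time step\<close>

lemma subdomain_within_domain:
  fixes a b :: "nat \<Rightarrow> real"
  assumes "\<And>j. 1 \<le> j \<Longrightarrow> j \<le> N - 1 \<Longrightarrow> b j = a (j + 1)"
    and lt: "\<And>j. 1 \<le> j \<Longrightarrow> j \<le> N \<Longrightarrow> a j < b j" and j: "1 \<le> j" "j \<le> N"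
  shows "a 1 \<le> a j" "b j \<le> b N"
proof -
  show "a 1 \<le> a j"
    using j
  proof (induction j rule: dec_induct)
    case (step k)
    then show ?case
      using assms(1)[of k] lt[of k] by simp
  qed simp
  show "b j \<le> b N"
    using j(2) j(1)
  proof (induction j rule: inc_induct)
    case (step k)
    then show ?case
      using assms(1)[of k] lt[of "Suc k"] by simp
  qed simp
qed

theorem proposition1:
  fixes N NT :: nat
    and T dt p :: real
    and a b :: "nat \<Rightarrow> real"
    and K :: "nat \<Rightarrow> nat"
    and xs :: "nat \<Rightarrow> nat \<Rightarrow> real"
    and V :: "real \<Rightarrow> real \<Rightarrow> real"
  assumes "2 \<le> N" and "1 \<le> NT"
    and "dt = T / real NT" and "0 < dt" and "0 < p"
    and "a 1 = a 0" and "b N = b 0"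
    and "\<And>j. 1 \<le> j \<Longrightarrow> j \<le> N - 1 \<Longrightarrow> b j = a (j + 1)"
    and "\<And>j. 1 \<le> j \<Longrightarrow> j \<le> N \<Longrightarrow> is_mesh (a j) (b j) (K j) (xs j)"
    and "\<And>n j \<alpha> \<beta>. 1 \<le> n \<Longrightarrow> n \<le> NT \<Longrightarrow> 1 \<le> j \<Longrightarrow> j \<le> N \<Longrightarrow>
           1 \<le> \<alpha> \<Longrightarrow> \<alpha> \<le> K j \<Longrightarrow> 1 \<le> \<beta> \<Longrightarrow> \<beta> \<le> K j \<Longrightarrow>
           (\<lambda>y. avg_potential V dt n y * hat (K j) (xs j) \<alpha> y * hat (K j) (xs j) \<beta> y)
             integrable_on {a j..b j}"
  shows "\<exists>L :: nat \<Rightarrow> complex mat.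
           (\<forall>n. 1 \<le> n \<and> n \<le> NT \<longrightarrow>
              L n \<in> carrier_mat (2 * N - 2) (2 * N - 2) \<and>
              (\<forall>u. (\<forall>j. 1 \<le> j \<and> j \<le> N \<longrightarrow> u j \<in> carrier_vec (K j)) \<longrightarrow>
                 (\<exists>d \<in> carrier_vec (2 * N - 2). \<forall>g \<in> carrier_vec (2 * N - 2).
                    interface_op N K xs dt p V n u g = L n *\<^sub>v g + d)) \<and>
              interface_sparsity N (L n)) \<and>
           ((\<exists>V\<^sub>0 :: real \<Rightarrow> real. \<forall>t\<in>{0..T}. \<forall>y\<in>{a 0<..<b 0}. V t y = V\<^sub>0 y) \<longrightarrow>
              (\<forall>m n. 1 \<le> m \<and> m \<le> NT \<and> 1 \<le> n \<and> n \<le> NT \<longrightarrow> L m = L n))"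
proof -
  note mesh = assms(9)
  define X where "X n = transmission_coeff N K xs dt p (avg_potential V dt n)" for n
  have time_independent: "interface_mat N (X m) = interface_mat N (X n)"
    if V0: "\<And>t y. t \<in> {0..T} \<Longrightarrow> y \<in> {a 0<..<b 0} \<Longrightarrow> V t y = V\<^sub>0 y"
      and mn: "1 \<le> m" "m \<le> NT" "1 \<le> n" "n \<le> NT" for V\<^sub>0 m n
  proof (rule interface_mat_cong)
    fix j assume j: "1 \<le> j" "j \<le> N"
    have times: "real k * dt \<in> {0..T}" if "k \<le> NT" for k
    proof -
      have "T = real NT * dt"
        using assms(2,3) by simp
      then show ?thesis
        using mult_right_mono[of "real k" "real NT" dt] that \<open>0 < dt\<close> by simp
    qed
    have W: "avg_potential V dt k y = V\<^sub>0 y" if "k \<le> NT" "y \<in> {a 0<..<b 0}" for k y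
      using V0[OF times[of k] that(2)] V0[OF times[of "k - 1"] that(2)] that by (simp add: avg_potential_def)
    have "a j < b j" if "1 \<le> j" "j \<le> N" for j
      using is_mesh_bounds[OF mesh[OF that]] by simp
    then have "a 0 \<le> a j" "b j \<le> b 0"
      using subdomain_within_domain[of N b a j] assms(6-8) j by auto
    then have "{xs j 1..xs j (K j)} - {a 0, b 0} \<subseteq> {a 0<..<b 0}"
      using is_mesh_bounds[OF mesh[OF j]] by auto
    \<comment> \<open>Nothing is known about the potential at the end points of the domain; they are a null set.\<close>
    then have "robin_mat N K xs dt p (avg_potential V dt m) j =
        robin_mat N K xs dt p (avg_potential V dt n) j"
      by (intro robin_mat_cong[of "{a 0, b 0}"]) (use W mn in auto)
    then show "X m j = X n j"
      by (simp add: X_def transmission_coeff_def fun_eq_iff)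
  qed
  show ?thesis
  proof (intro exI[of _ "\<lambda>n. interface_mat N (X n)"] conjI allI impI)
    fix n and u :: "nat \<Rightarrow> complex vec"
    assume "\<forall>j. 1 \<le> j \<and> j \<le> N \<longrightarrow> u j \<in> carrier_vec (K j)"
    then show "\<exists>d\<in>carrier_vec (2 * N - 2). \<forall>g\<in>carrier_vec (2 * N - 2).
        interface_op N K xs dt p V n u g = interface_mat N (X n) *\<^sub>v g + d"
      unfolding X_def
      by (intro interface_op_affine[where a = a and b = b] assms(1,4,5) mesh) auto
  next
    fix n show "interface_sparsity N (interface_mat N (X n))"
      by (rule interface_sparsity_interface_mat[OF \<open>2 \<le> N\<close>])
  next
    fix m n
    assume "\<exists>V\<^sub>0. \<forall>t\<in>{0..T}. \<forall>y\<in>{a 0<..<b 0}. V t y = V\<^sub>0 y"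
      and "1 \<le> m \<and> m \<le> NT \<and> 1 \<le> n \<and> n \<le> NT"
    then show "interface_mat N (X m) = interface_mat N (X n)"
      using time_independent by metis
  qed simp
qed

end
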